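(* Let $q$ be a prime power and let $\mathcal{A}$ be a central hyperplane arrangement in $\mathbb{F}_q^3$. If $\chi(\mathcal{A},q)=0$, then $\mathcal{A}$ is free with exponents $(1,q,|\mathcal{A}|-q-1)$.
   Context: A (central) hyperplane arrangement $\mathcal{A}$ in $V=\mathbb{K}^\ell$ is a finite set of codimension-one linear subspaces. Characteristic polynomial: $\chi(\mathcal{A},t)=\sum_{X\in L(\mathcal{A})}\mu(X)t^{\dim X}$, where $L(\mathcal{A})$ is the set of intersections of subsets of $\mathcal{A}$ (including $V$) ordered by reverse inclusion with minimum $\hat0=V$, and $\mu(\hat0)=1$, $\mu(X)=-\sum_{Y<X}\mu(Y)$ for $X>\hat0$. Let $S=\mathbb{K}[x_1,\dots,x_\ell]$, fix for each $H\in\mathcal{A}$ a nonzero linear form $\alpha_H$ with kernel $H$; $D(\mathcal{A})=\{\delta\in \mathrm{Der}_V : \delta(\alpha_H)\in\alpha_H S\ \forall H\in\mathcal{A}\}$, where $\mathrm{Der}_V=\bigoplus_i S\,\partial/\partial x_i$. $\mathcal{A}$ is free if $D(\mathcal{A})$ is a free $S$-module; the exponents are the multiset of degrees of a homogeneous basis. *)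

theory Defs
  imports "HOL-Analysis.Cartesian_Space" "HOL-Computational_Algebra.Polynomial"
begin

text \<open>Ambient space V = k^3 for a finite field k (so k = F_q with q = CARD('k)).\<close>

definition lin_fun :: "'k::field ^ 3 \<Rightarrow> 'k ^ 3 \<Rightarrow> 'k" where
  "lin_fun a x = (\<Sum>i\<in>UNIV. a $ i * x $ i)"

definition is_hyperplane :: "('k::field ^ 3) set \<Rightarrow> bool" where
  "is_hyperplane H \<longleftrightarrow> (\<exists>a. a \<noteq> 0 \<and> H = {x. lin_fun a x = 0})"

definition central_arrangement :: "('k::field ^ 3) set set \<Rightarrow> bool" where
  "central_arrangement A \<longleftrightarrow> finite A \<and> (\<forall>H\<in>A. is_hyperplane H)"

text \<open>Intersection lattice: intersections of subsets of A (the empty intersection is V).\<close>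
definition intersection_lattice :: "('k::field ^ 3) set set \<Rightarrow> ('k ^ 3) set set" where
  "intersection_lattice A = {\<Inter> B | B. B \<subseteq> A}"

text \<open>Moebius function on L, ordered by reverse inclusion, minimum V:
  mu V = 1, mu X = - sum of mu Y over Y in L with Y < X (i.e. Y strictly contains X).\<close>
function mobius :: "('k::{finite,field} ^ 3) set set \<Rightarrow> ('k ^ 3) set \<Rightarrow> int" where
  "mobius L X = (if X = UNIV then 1 else - (\<Sum>Y\<in>{Y\<in>L. X \<subset> Y}. mobius L Y))"
  by auto
termination
proof (relation "measure (\<lambda>(L, X). card (UNIV - X))")
  show "wf (measure (\<lambda>(L, X). card (UNIV - X)))" by simp
next
  fix L :: "('k::{finite,field} ^ 3) set set" and X Y
  assume "X \<noteq> UNIV" "Y \<in> {Y \<in> L. X \<subset> Y}"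
  then have "UNIV - Y \<subset> UNIV - X" by auto
  then show "((L, Y), L, X) \<in> measure (\<lambda>(L, X). card (UNIV - X))"
    by (simp add: psubset_card_mono)
qed

definition char_poly :: "('k::{finite,field} ^ 3) set set \<Rightarrow> int poly" where
  "char_poly A = (\<Sum>X\<in>intersection_lattice A.
      monom (mobius (intersection_lattice A) X) (vec.dim X))"

text \<open>The polynomial ring S = k[x_0,x_1,x_2], realised as nested univariate polynomials
  (x_0 innermost, x_2 outermost).\<close>
type_synonym 'k pol3 = "'k poly poly poly"

definition pconst :: "'k::comm_ring_1 \<Rightarrow> 'k pol3" where
  "pconst c = [:[:[:c:]:]:]"

definition pvar :: "3 \<Rightarrow> 'k::comm_ring_1 pol3" where
  "pvar i = (if i = 0 then [:[:monom 1 1:]:] else if i = 1 then [:monom 1 1:] else monom 1 1)"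

definition mcoeff :: "'k::zero pol3 \<Rightarrow> nat \<Rightarrow> nat \<Rightarrow> nat \<Rightarrow> 'k" where
  "mcoeff p i j k = coeff (coeff (coeff p k) j) i"

definition homogeneous :: "nat \<Rightarrow> 'k::zero pol3 \<Rightarrow> bool" where
  "homogeneous d p \<longleftrightarrow> (\<forall>i j k. mcoeff p i j k \<noteq> 0 \<longrightarrow> i + j + k = d)"

definition lin_form :: "'k::comm_ring_1 ^ 3 \<Rightarrow> 'k pol3" where
  "lin_form a = (\<Sum>i\<in>UNIV. pconst (a $ i) * pvar i)"

text \<open>A derivation theta = sum f_i d/dx_i is identified with (f_0,f_1,f_2) in S^3;
  theta(alpha) = sum a_i f_i for alpha = sum a_i x_i.\<close>
definition der_apply :: "'k::comm_ring_1 pol3 ^ 3 \<Rightarrow> 'k ^ 3 \<Rightarrow> 'k pol3" where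
  "der_apply \<theta> a = (\<Sum>i\<in>UNIV. pconst (a $ i) * \<theta> $ i)"

definition homogeneous_der :: "nat \<Rightarrow> 'k::zero pol3 ^ 3 \<Rightarrow> bool" where
  "homogeneous_der d \<theta> \<longleftrightarrow> (\<forall>i. homogeneous d (\<theta> $ i))"

definition der_module :: "('k::field ^ 3) set set \<Rightarrow> ('k pol3 ^ 3) set" where
  "der_module A = {\<theta>. \<forall>H\<in>A. \<forall>a. a \<noteq> 0 \<and> H = {x. lin_fun a x = 0} \<longrightarrow>
       lin_form a dvd der_apply \<theta> a}"

definition free_with_exponents :: "('k::field ^ 3) set set \<Rightarrow> nat \<Rightarrow> nat \<Rightarrow> nat \<Rightarrow> bool" where
  "free_with_exponents A d1 d2 d3 \<longleftrightarrow>
     (\<exists>\<theta>1 \<theta>2 \<theta>3. \<theta>1 \<in> der_module A \<and> \<theta>2 \<in> der_module A \<and> \<theta>3 \<in> der_module A \<and>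
        homogeneous_der d1 \<theta>1 \<and> homogeneous_der d2 \<theta>2 \<and> homogeneous_der d3 \<theta>3 \<and>
        (\<forall>\<theta>\<in>der_module A. \<exists>!(g1, g2, g3).
            \<theta> = g1 *s \<theta>1 + g2 *s \<theta>2 + g3 *s \<theta>3))"

end

theory Submission
  imports Defs
begin

text \<open>
  By Moebius inversion \<open>\<chi>(A, q)\<close> counts the points of \<open>k\<^sup>3\<close> on no hyperplane, so the hypothesis says
  that the product \<open>Q\<close> of the defining forms vanishes at every point. A homogeneous polynomial that
  does so lies in the ideal of the minors \<open>x\<^sub>i x\<^sub>j\<^sup>q - x\<^sub>j x\<^sub>i\<^sup>q\<close>, with homogeneous coefficients. The minors are
  the cross product of the derivations \<open>\<theta>\<^sub>1 = \<Sum> x\<^sub>i \<partial>\<^sub>i\<close> and \<open>\<theta>\<^sub>2 = \<Sum> x\<^sub>i\<^sup>q \<partial>\<^sub>i\<close>, both of which preserve every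
  hyperplane; hence the coefficients form a third derivation with \<open>det (\<theta>\<^sub>1, \<theta>\<^sub>2, \<theta>\<^sub>3) = Q\<close>. It also
  preserves the hyperplanes, and Saito's criterion applies.
\<close>

section \<open>Point counts of subspaces and Moebius inversion over a finite field\<close>

lemma card_span_independent:
  fixes B :: "('k::{finite,field} ^ 'n) set"
  assumes "vec.independent B"
  shows "card (vec.span B) = CARD('k) ^ card B"
proof -
  have "finite B" using assms vec.finiteI_independent by blast
  then show ?thesis using assms
  proof (induction B)
    case empty
    then show ?case by simp
  next
    case (insert b B)
    have ind: "vec.independent B" "b \<notin> vec.span B"
      using insert.prems insert.hyps by (auto simp: vec.independent_insert)
    let ?f = "\<lambda>(c, y). c *s b + y"
    have "vec.span (insert b B) = ?f ` (UNIV \<times> vec.span B)"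
    proof (intro equalityI subsetI)
      fix x assume "x \<in> vec.span (insert b B)"
      then obtain c where "x - c *s b \<in> vec.span B" by (auto simp: vec.span_insert)
      then have "(c, x - c *s b) \<in> UNIV \<times> vec.span B" "x = ?f (c, x - c *s b)" by auto
      then show "x \<in> ?f ` (UNIV \<times> vec.span B)" by blast
    next
      fix x assume "x \<in> ?f ` (UNIV \<times> vec.span B)"
      then obtain c y where "y \<in> vec.span B" "x = c *s b + y" by auto
      then have "x - c *s b \<in> vec.span B" by simp
      then show "x \<in> vec.span (insert b B)" by (auto simp: vec.span_insert)
    qed
    moreover have "inj_on ?f (UNIV \<times> vec.span B)"
    proof (rule inj_onI, clarify)
      fix c y c' y'
      assume y: "y \<in> vec.span B" "y' \<in> vec.span B" and eq: "c *s b + y = c' *s b + y'"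
      have "(c - c') *s b = y' - y" using eq by (simp add: vec.scale_left_diff_distrib algebra_simps)
      then have m: "(c - c') *s b \<in> vec.span B" using y by (simp add: vec.span_diff)
      have "c = c'"
      proof (rule ccontr)
        assume "c \<noteq> c'"
        have "inverse (c - c') *s ((c - c') *s b) \<in> vec.span B" by (rule vec.span_scale[OF m])
        with \<open>c \<noteq> c'\<close> ind show False by simp
      qed
      with eq show "c = c' \<and> y = y'" by simp
    qed
    ultimately have "card (vec.span (insert b B)) = CARD('k) * card (vec.span B)"
      by (simp add: card_image card_cartesian_product)
    with insert ind show ?case by simp
  qed
qed

text \<open>This turns the exponent \<open>vec.dim X\<close> in \<open>char_poly\<close>, evaluated
  at q, into a number of points.\<close>

lemma card_subspace:
  fixes S :: "('k::{finite,field} ^ 'n) set"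
  assumes "vec.subspace S"
  shows "card S = CARD('k) ^ vec.dim S"
proof -
  obtain B where B: "B \<subseteq> S" "vec.independent B" "S \<subseteq> vec.span B" "card B = vec.dim S"
    using vec.basis_exists by blast
  then have "vec.span B = S" using assms by (metis vec.span_subspace)
  with card_span_independent[OF B(2)] B(4) show ?thesis by simp
qed

lemma subspace_hyperplane:
  assumes "is_hyperplane H" shows "vec.subspace H"
  using assms unfolding is_hyperplane_def vec.subspace_def lin_fun_def
  by (auto simp: algebra_simps sum.distrib simp flip: sum_distrib_left)

lemma lin_fun_axis: "lin_fun a (axis i c) = a $ i * c"
proof -
  have "lin_fun a (axis i c) = (\<Sum>j\<in>UNIV. if j = i then a $ i * c else 0)"
    unfolding lin_fun_def axis_def by (intro sum.cong) auto
  then show ?thesis by simp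
qed

lemma hyperplane_neq_UNIV:
  fixes H :: "('k::field ^ 3) set"
  assumes "is_hyperplane H" shows "H \<noteq> UNIV"
proof
  assume "H = UNIV"
  then obtain a :: "'k ^ 3" where a: "a \<noteq> 0" "UNIV = {x. lin_fun a x = 0}"
    using assms unfolding is_hyperplane_def by auto
  then have 0: "lin_fun a x = 0" for x by blast
  have "a $ i = 0" for i using 0[of "axis i 1"] by (simp add: lin_fun_axis)
  with a(1) show False by (simp add: vec_eq_iff)
qed

declare mobius.simps [simp del]

text \<open>The recursion for \<open>mobius\<close>, with the term at \<open>X\<close> moved into
  the sum. The inversion is applied in this form to the smallest flat through a point.\<close>

lemma sum_mobius_above:
  fixes L :: "('k::{finite,field} ^ 3) set set"
  assumes "X \<in> L" "UNIV \<in> L"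
  shows "(\<Sum>Y\<in>{Y\<in>L. X \<subseteq> Y}. mobius L Y) = (if X = UNIV then 1 else 0)"
proof (cases "X = UNIV")
  case True
  then have "{Y\<in>L. X \<subseteq> Y} = {UNIV}" using assms by auto
  then show ?thesis using True by (simp add: mobius.simps[of L UNIV])
next
  case False
  have "{Y\<in>L. X \<subseteq> Y} = insert X {Y\<in>L. X \<subset> Y}" using assms by auto
  then have "(\<Sum>Y\<in>{Y\<in>L. X \<subseteq> Y}. mobius L Y) = mobius L X + (\<Sum>Y\<in>{Y\<in>L. X \<subset> Y}. mobius L Y)"
    by simp
  also have "\<dots> = 0" using False by (simp add: mobius.simps[of L X])
  finally show ?thesis using False by simp
qed

text \<open>Each point \<open>x\<close> lies in exactly the flats containing the smallest flat through \<open>x\<close>,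
  so counting pairs of a point and a flat turns Moebius inversion into a count of
  uncovered points.\<close>
lemma poly_char_poly_card:
  fixes A :: "('k::{finite,field} ^ 3) set set"
  assumes A: "central_arrangement A"
  shows "poly (char_poly A) (int CARD('k)) = int (card (- \<Union>A))"
proof -
  let ?L = "intersection_lattice A" and ?q = "int CARD('k)"
  have hyp: "\<And>H. H \<in> A \<Longrightarrow> is_hyperplane H" using A by (simp add: central_arrangement_def)
  have sub: "vec.subspace X" if X: "X \<in> ?L" for X
  proof -
    obtain B where "B \<subseteq> A" "X = \<Inter>B" using X by (auto simp: intersection_lattice_def)
    then show ?thesis using hyp by (auto intro!: vec.subspace_Inter intro: subspace_hyperplane)
  qed
  have U: "UNIV \<in> ?L" unfolding intersection_lattice_def by (rule CollectI, rule exI[of _ "{}"]) simp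
  have "poly (char_poly A) ?q = (\<Sum>X\<in>?L. mobius ?L X * ?q ^ vec.dim X)"
    by (simp add: char_poly_def poly_sum poly_monom)
  also have "\<dots> = (\<Sum>X\<in>?L. mobius ?L X * int (card X))"
    using sub by (intro sum.cong) (auto simp: card_subspace)
  also have "\<dots> = (\<Sum>X\<in>?L. \<Sum>x\<in>UNIV. if x \<in> X then mobius ?L X else 0)"
    by (intro sum.cong) (auto simp: sum.If_cases)
  also have "\<dots> = (\<Sum>x\<in>UNIV. \<Sum>X\<in>?L. if x \<in> X then mobius ?L X else 0)"
    by (rule sum.swap)
  also have "\<dots> = (\<Sum>x\<in>UNIV. if x \<in> - \<Union>A then 1 else 0)"
  proof (intro sum.cong refl)
    fix x :: "'k ^ 3"
    \<comment> \<open>The smallest flat through \<open>x\<close>. It is \<open>UNIV\<close> exactly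
      when no member of \<open>A\<close> contains \<open>x\<close>, since every hyperplane is
      proper.\<close>
    let ?X = "\<Inter>{H\<in>A. x \<in> H}"
    have X: "?X \<in> ?L" by (auto simp: intersection_lattice_def)
    have "x \<in> Y \<longleftrightarrow> ?X \<subseteq> Y" if Y: "Y \<in> ?L" for Y
    proof -
      obtain B where "B \<subseteq> A" "Y = \<Inter>B" using Y by (auto simp: intersection_lattice_def)
      then show ?thesis by auto
    qed
    then have eq: "{Y \<in> ?L. x \<in> Y} = {Y \<in> ?L. ?X \<subseteq> Y}" by blast
    have "(\<Sum>X\<in>?L. if x \<in> X then mobius ?L X else 0) = (\<Sum>Y\<in>{Y \<in> ?L. x \<in> Y}. mobius ?L Y)"
      by (simp add: sum.inter_filter)
    also have "\<dots> = (if ?X = UNIV then 1 else 0)" using sum_mobius_above[OF X U] by (simp only: eq)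
    also have "?X = UNIV \<longleftrightarrow> x \<in> - \<Union>A" using hyperplane_neq_UNIV[OF hyp] by (auto simp: Inter_UNIV_conv)
    finally show "(\<Sum>X\<in>?L. if x \<in> X then mobius ?L X else 0) = (if x \<in> - \<Union>A then 1 else 0)" .
  qed
  also have "\<dots> = int (card (- \<Union>A))" by (simp only: sum.If_cases finite) (simp add: Compl_eq)
  finally show ?thesis .
qed

section \<open>Evaluation, substitution and linear forms\<close>

text \<open>Numerals of type \<open>3\<close> are residues modulo 3. The library lemmas index by 1,
  2, 3, whereas \<open>pvar\<close> uses 0, 1, 2.\<close>

lemma three_eq_zero: "(3::3) = 0"
  by (simp add: eq_numeral_iff_iszero)

lemma sum_UNIV_3: "(\<Sum>i\<in>UNIV. f (i::3)) = f 0 + f 1 + f 2"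
proof -
  have "f 3 = f 0" by (simp add: three_eq_zero)
  then show ?thesis by (simp add: sum_3 ac_simps)
qed

lemma all_index_3: "(\<forall>i::3. P i) \<longleftrightarrow> P 0 \<and> P 1 \<and> P 2"
proof -
  have "P 3 = P 0" by (simp add: three_eq_zero)
  then show ?thesis by (simp add: forall_3 conj_ac)
qed

lemma index_3_cases: "(i::3) = 0 \<or> i = 1 \<or> i = 2"
proof -
  have "\<forall>i::3. i = 0 \<or> i = 1 \<or> i = 2" unfolding all_index_3 by simp
  then show ?thesis by blast
qed

lemma pconst_simps [simp]:
  "pconst 0 = 0" "pconst 1 = 1" "pconst (a + b) = pconst a + pconst b"
  "pconst (a - b) = pconst a - pconst b" "pconst (- a) = - pconst a"
  "pconst (a * b) = pconst a * pconst b"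
  by (simp_all add: pconst_def one_pCons)

lemma pvar_simps: "pvar 0 = [:[:monom 1 1:]:]" "pvar 1 = [:monom 1 1:]" "pvar 2 = monom 1 1"
  by (simp_all add: pvar_def)

text \<open>Constants and variables generate the polynomial ring. Each of the three nested layers is
  built up by \<open>pCons a p\<close> = a + x p, x being the variable of that layer.\<close>

lemma pol3_induct [case_names const var add mult]:
  fixes p :: "'k::comm_ring_1 pol3"
  assumes const: "\<And>c. P (pconst c)" and var: "\<And>i. P (pvar i)"
    and add: "\<And>p q. P p \<Longrightarrow> P q \<Longrightarrow> P (p + q)"
    and mult: "\<And>p q. P p \<Longrightarrow> P q \<Longrightarrow> P (p * q)"
  shows "P p"
proof -
  have 0: "P 0" using const[of 0] by simp
  have 1: "P [:[:r:]:]" for r :: "'k poly"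
  proof (induction r)
    case 0 then show ?case using \<open>P 0\<close> by simp
  next
    case (pCons a r)
    have "[:[:pCons a r:]:] = pconst a + pvar 0 * [:[:r:]:]"
      by (simp add: pconst_def pvar_simps monom_altdef)
    then show ?case using const[of a] var[of 0] pCons.IH add mult by metis
  qed
  have 2: "P [:r:]" for r :: "'k poly poly"
  proof (induction r)
    case 0 then show ?case using \<open>P 0\<close> by simp
  next
    case (pCons a r)
    have "[:pCons a r:] = [:[:a:]:] + pvar 1 * [:r:]"
      by (simp add: pvar_simps monom_altdef)
    then show ?case using 1[of a] var[of 1] pCons.IH add mult by metis
  qed
  show ?thesis
  proof (induction p)
    case 0 then show ?case using \<open>P 0\<close> by simp
  next
    case (pCons a p)
    have "pCons a p = [:a:] + pvar 2 * p"
      by (simp add: pvar_simps monom_altdef)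
    then show ?case using 2[of a] var[of 2] pCons.IH add mult by metis
  qed
qed

definition ring_hom_fun :: "('a::comm_ring_1 \<Rightarrow> 'b::comm_ring_1) \<Rightarrow> bool" where
  "ring_hom_fun h \<longleftrightarrow> h 0 = 0 \<and> h 1 = 1 \<and> (\<forall>x y. h (x + y) = h x + h y) \<and> (\<forall>x y. h (x * y) = h x * h y)"

lemma ring_hom_fun_sum:
  assumes "ring_hom_fun h" shows "h (sum f S) = (\<Sum>x\<in>S. h (f x))"
  using assms by (induction S rule: infinite_finite_induct) (auto simp: ring_hom_fun_def)

lemma ring_hom_fun_prod:
  assumes "ring_hom_fun h" shows "h (prod f S) = (\<Prod>x\<in>S. h (f x))"
  using assms by (induction S rule: infinite_finite_induct) (auto simp: ring_hom_fun_def)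

lemma ring_hom_fun_power:
  assumes "ring_hom_fun h" shows "h (x ^ n) = h x ^ n"
  using assms by (induction n) (auto simp: ring_hom_fun_def)

lemma ring_hom_fun_diff:
  assumes "ring_hom_fun h" shows "h (x - y) = h x - h y"
proof -
  have "h (x - y + y) = h (x - y) + h y" using assms unfolding ring_hom_fun_def by blast
  then show ?thesis by simp
qed

lemma ring_hom_fun_poly_map_poly:
  fixes h :: "'a::comm_ring_1 \<Rightarrow> 'b::comm_ring_1"
  assumes h: "ring_hom_fun h" shows "ring_hom_fun (\<lambda>p. poly (map_poly h p) v)"
proof -
  have h0: "h 0 = 0" and h1: "h 1 = 1" and ha: "\<And>x y. h (x + y) = h x + h y"
    and hm: "\<And>x y. h (x * y) = h x * h y" using h by (auto simp: ring_hom_fun_def)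
  have "map_poly h 1 = 1" by (intro poly_eqI) (simp add: coeff_map_poly h0 h1)
  moreover have "map_poly h (p + q) = map_poly h p + map_poly h q" for p q
    by (intro poly_eqI) (simp add: coeff_map_poly h0 ha)
  moreover have "map_poly h (p * q) = map_poly h p * map_poly h q" for p q
    by (intro poly_eqI) (simp add: coeff_map_poly h0 coeff_mult ring_hom_fun_sum[OF h] hm)
  ultimately show ?thesis by (simp add: ring_hom_fun_def)
qed

text \<open>The target ring is left open to serve two purposes: the identity as \<open>h\<close>
  gives values at points of \<open>k^3\<close>, and \<open>pconst\<close> as \<open>h\<close> gives
  substitution of polynomials for the variables.\<close>

definition peval :: "('k::comm_ring_1 \<Rightarrow> 'r::comm_ring_1) \<Rightarrow> 'r ^ 3 \<Rightarrow> 'k pol3 \<Rightarrow> 'r" where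
  "peval h v p = poly (map_poly (\<lambda>r. poly (map_poly (\<lambda>s. poly (map_poly h s) (v $ 0)) r) (v $ 1)) p) (v $ 2)"

lemma ring_hom_fun_peval: "ring_hom_fun h \<Longrightarrow> ring_hom_fun (peval h v)"
  unfolding peval_def[abs_def] by (intro ring_hom_fun_poly_map_poly)

lemma ring_hom_fun_pconst: "ring_hom_fun pconst"
  by (simp add: ring_hom_fun_def)

lemma ring_hom_fun_id: "ring_hom_fun (\<lambda>x. x)"
  by (simp add: ring_hom_fun_def)

lemma peval_pconst:
  assumes "ring_hom_fun h" shows "peval h v (pconst c) = h c"
  using assms by (simp add: peval_def pconst_def map_poly_pCons ring_hom_fun_def)

lemma peval_pvar:
  assumes "ring_hom_fun h" shows "peval h v (pvar i) = v $ i"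
  using index_3_cases[of i] assms
  by (auto simp: peval_def pvar_simps monom_altdef map_poly_pCons ring_hom_fun_def)

lemma peval_lin_form:
  assumes "ring_hom_fun h" shows "peval h v (lin_form a) = (\<Sum>i\<in>UNIV. h (a $ i) * v $ i)"
proof -
  have "peval h v (x * y) = peval h v x * peval h v y" for x y
    using ring_hom_fun_peval[OF assms] by (simp add: ring_hom_fun_def)
  then show ?thesis
    by (simp add: lin_form_def ring_hom_fun_sum[OF ring_hom_fun_peval[OF assms]] peval_pconst peval_pvar assms)
qed

abbreviation point_eval :: "'k::comm_ring_1 ^ 3 \<Rightarrow> 'k pol3 \<Rightarrow> 'k" where
  "point_eval \<equiv> peval (\<lambda>x. x)"

lemma point_eval_simps [simp]:
  "point_eval v 0 = 0" "point_eval v 1 = 1"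
  "point_eval v (p + q) = point_eval v p + point_eval v q"
  "point_eval v (p - q) = point_eval v p - point_eval v q"
  "point_eval v (p * q) = point_eval v p * point_eval v q"
  "point_eval v (p ^ n) = point_eval v p ^ n"
  "point_eval v (sum f S) = (\<Sum>x\<in>S. point_eval v (f x))"
  "point_eval v (prod f S) = (\<Prod>x\<in>S. point_eval v (f x))"
  "point_eval v (pconst c) = c" "point_eval v (pvar i) = v $ i"
  "point_eval v (lin_form a) = lin_fun a v"
  using ring_hom_fun_peval[OF ring_hom_fun_id, of v]
  by (simp_all add: ring_hom_fun_sum ring_hom_fun_prod ring_hom_fun_power ring_hom_fun_diff
      peval_pconst peval_pvar peval_lin_form ring_hom_fun_id lin_fun_def)
     (simp_all add: ring_hom_fun_def)

text \<open>A substitution that fixes every variable modulo \<open>m\<close> fixes every polynomial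
  modulo \<open>m\<close>.\<close>

lemma dvd_diff_peval:
  fixes v :: "'k::comm_ring_1 pol3 ^ 3"
  assumes "\<And>i. m dvd pvar i - v $ i"
  shows "m dvd p - peval pconst v p"
proof (induction p rule: pol3_induct)
  case (const c)
  then show ?case by (simp add: peval_pconst ring_hom_fun_pconst)
next
  case (var i)
  then show ?case using assms by (simp add: peval_pvar ring_hom_fun_pconst)
next
  case (add p q)
  have "p + q - peval pconst v (p + q) = (p - peval pconst v p) + (q - peval pconst v q)"
    using ring_hom_fun_peval[OF ring_hom_fun_pconst, of v] by (simp add: ring_hom_fun_def)
  then show ?case using add by (metis dvd_add)
next
  case (mult p q)
  have "p * q - peval pconst v (p * q) = (p - peval pconst v p) * q + peval pconst v p * (q - peval pconst v q)"
    using ring_hom_fun_peval[OF ring_hom_fun_pconst, of v] by (simp add: ring_hom_fun_def algebra_simps)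
  then show ?case using mult by (metis dvd_add dvd_mult dvd_mult2)
qed

text \<open>For \<open>a $ i \<noteq> 0\<close> this solves the equation \<open>lin_form a\<close> =
  0 for the variable \<open>pvar i\<close>; the new entry no longer involves
  \<open>pvar i\<close>.\<close>

definition lin_subst :: "'k::field ^ 3 \<Rightarrow> 3 \<Rightarrow> 'k pol3 ^ 3" where
  "lin_subst a i = (\<chi> j. if j = i then pvar i - pconst (inverse (a $ i)) * lin_form a else pvar j)"

text \<open>The substitution kills \<open>lin_form a\<close> and changes each variable only by a
  multiple of it, so its kernel is the principal ideal of \<open>lin_form a\<close>.\<close>

lemma lin_form_dvd_iff:
  assumes "a $ i \<noteq> 0"
  shows "lin_form a dvd p \<longleftrightarrow> peval pconst (lin_subst a i) p = 0"
proof
  let ?v = "lin_subst a i"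
  note hom = ring_hom_fun_peval[OF ring_hom_fun_pconst, of ?v]
  have "peval pconst ?v (lin_form a) = (\<Sum>j\<in>UNIV. pconst (a $ j) * pvar j - (if j = i then pconst (a $ i * inverse (a $ i)) * lin_form a else 0))"
    unfolding peval_lin_form[OF ring_hom_fun_pconst]
    by (intro sum.cong) (auto simp: lin_subst_def algebra_simps)
  also have "\<dots> = 0"
    using assms by (simp add: sum_subtractf lin_form_def del: pconst_simps(6))
  finally have 0: "peval pconst ?v (lin_form a) = 0" .
  show "peval pconst ?v p = 0" if "lin_form a dvd p"
    using that 0 hom by (auto simp: ring_hom_fun_def elim!: dvdE)
  have "lin_form a dvd p - peval pconst ?v p"
    by (intro dvd_diff_peval) (auto simp: lin_subst_def)
  then show "lin_form a dvd p" if "peval pconst ?v p = 0" using that by simp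
qed

lemma lin_form_neq_0:
  fixes a :: "'k::field ^ 3"
  assumes "a \<noteq> 0" shows "lin_form a \<noteq> 0"
proof
  assume "lin_form a = 0"
  then have "point_eval (axis i 1) (lin_form a) = 0" for i by simp
  then have "a $ i = 0" for i by (simp add: lin_fun_axis)
  then show False using assms by (simp add: vec_eq_iff)
qed

text \<open>The ideal of \<open>lin_form a\<close> is the kernel of a ring homomorphism into an
  integral domain.\<close>

lemma prime_elem_lin_form:
  fixes a :: "'k::field ^ 3"
  assumes "a \<noteq> 0" shows "prime_elem (lin_form a)"
proof -
  obtain i where i: "a $ i \<noteq> 0" using assms by (auto simp: vec_eq_iff)
  have "ring_hom_fun (peval pconst (lin_subst a i))"
    by (intro ring_hom_fun_peval ring_hom_fun_pconst)
  then show ?thesis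
    using lin_form_neq_0[OF assms]
    by (auto simp: prime_elem_def lin_form_dvd_iff[OF i] ring_hom_fun_def)
qed

lemma lin_fun_kernel_subset:
  fixes a b :: "'k::field ^ 3"
  assumes a: "a $ i \<noteq> 0" and sub: "{x. lin_fun a x = 0} \<subseteq> {x. lin_fun b x = 0}"
  shows "b = (b $ i / a $ i) *s a"
proof -
  have add: "lin_fun c (x + y) = lin_fun c x + lin_fun c y" for c x y :: "'k ^ 3"
    by (simp add: lin_fun_def algebra_simps sum.distrib)
  have "b $ j * a $ i = b $ i * a $ j" for j
  proof -
    \<comment> \<open>These vectors lie in the kernel of \<open>a\<close>; evaluating
      \<open>b\<close> on them gives the vanishing 2 by 2 minors of \<open>a\<close> and
      \<open>b\<close>.\<close>
    have "lin_fun a (axis j (a $ i) + axis i (- a $ j)) = 0"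
      unfolding add by (simp add: lin_fun_axis)
    then have "lin_fun b (axis j (a $ i) + axis i (- a $ j)) = 0" using sub by auto
    then show ?thesis unfolding add by (simp add: lin_fun_axis)
  qed
  then show ?thesis using a by (simp add: vec_eq_iff field_simps)
qed

lemma lin_form_scale: "lin_form (c *s a) = pconst c * lin_form a"
  by (simp add: lin_form_def sum_distrib_left mult.assoc)

lemma der_apply_scale: "der_apply \<theta> (c *s a) = pconst c * der_apply \<theta> a"
  by (simp add: der_apply_def sum_distrib_left mult.assoc)

lemma lin_form_not_dvd:
  fixes a b :: "'k::field ^ 3"
  assumes "a \<noteq> 0" "b \<noteq> 0" "{x. lin_fun a x = 0} \<noteq> {x. lin_fun b x = 0}"
  shows "\<not> lin_form a dvd lin_form b"
proof
  assume "lin_form a dvd lin_form b"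
  then obtain g where g: "lin_form b = lin_form a * g" by (elim dvdE)
  have sub: "{x. lin_fun a x = 0} \<subseteq> {x. lin_fun b x = 0}"
  proof (intro subsetI CollectI; elim CollectE)
    fix x assume "lin_fun a x = 0"
    then show "lin_fun b x = 0" using arg_cong[OF g, of "point_eval x"] by simp
  qed
  obtain i where i: "a $ i \<noteq> 0" using assms by (auto simp: vec_eq_iff)
  define c where "c = b $ i / a $ i"
  have b: "b = c *s a" unfolding c_def using lin_fun_kernel_subset[OF i sub] .
  then have "c \<noteq> 0" using assms by auto
  then have "{x. lin_fun a x = 0} = {x. lin_fun b x = 0}"
    unfolding b by (auto simp: lin_fun_def mult.assoc simp flip: sum_distrib_left)
  with assms show False by blast
qed

section \<open>Homogeneous polynomials vanishing on all points\<close>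

lemma pol3_eqI:
  assumes "\<And>i j k. mcoeff p i j k = mcoeff q i j k" shows "p = q"
  using assms by (intro poly_eqI) (simp add: mcoeff_def)

lemma mcoeff_simps [simp]:
  "mcoeff 0 i j k = 0"
  "mcoeff (p + q) i j k = mcoeff p i j k + mcoeff q i j k"
  "mcoeff (p - q) i j k = mcoeff p i j k - mcoeff q i j k"
  "mcoeff (sum f S) i j k = (\<Sum>x\<in>S. mcoeff (f x) i j k)"
  by (simp_all add: mcoeff_def coeff_sum)

lemma mcoeff_mult:
  "mcoeff (p * q) i j k = (\<Sum>k'\<le>k. \<Sum>j'\<le>j. \<Sum>i'\<le>i. mcoeff p i' j' k' * mcoeff q (i - i') (j - j') (k - k'))"
  by (simp add: mcoeff_def coeff_mult coeff_sum)

definition mterm :: "'k::comm_ring_1 \<Rightarrow> nat \<Rightarrow> nat \<Rightarrow> nat \<Rightarrow> 'k pol3" where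
  "mterm c i j k = pconst c * pvar 0 ^ i * pvar 1 ^ j * pvar 2 ^ k"

lemma const_poly_power: "[:x:] ^ n = [:x ^ n:]" for x :: "'a::comm_ring_1"
  by (induction n) auto

lemma mterm_eq_monom: "mterm c i j k = monom (monom (monom c i) j) k"
  unfolding mterm_def pconst_def pvar_simps const_poly_power monom_power
  by (simp add: smult_monom mult_monom)

lemma mcoeff_mterm: "mcoeff (mterm c i j k) i' j' k' = (if i' = i \<and> j' = j \<and> k' = k then c else 0)"
  by (auto simp: mterm_eq_monom mcoeff_def)

lemma mterm_add: "mterm (c + d) i j k = mterm c i j k + mterm d i j k"
  by (simp add: mterm_def algebra_simps)

lemma mterm_0 [simp]: "mterm 0 i j k = 0"
  by (simp add: mterm_def)

lemma point_eval_mterm [simp]: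
  fixes v :: "'k::field ^ 3"
  shows "point_eval v (mterm c i j k) = c * v $ 0 ^ i * v $ 1 ^ j * v $ 2 ^ k"
  by (simp add: mterm_def)

lemma homogeneous_0: "homogeneous d 0"
  by (simp add: homogeneous_def)

lemma homogeneous_add: "homogeneous d p \<Longrightarrow> homogeneous d q \<Longrightarrow> homogeneous d (p + q)"
  for p :: "'k::comm_ring_1 pol3"
  unfolding homogeneous_def mcoeff_simps by (metis add.right_neutral)

lemma homogeneous_diff: "homogeneous d p \<Longrightarrow> homogeneous d q \<Longrightarrow> homogeneous d (p - q)"
  for p :: "'k::comm_ring_1 pol3"
  unfolding homogeneous_def mcoeff_simps by (metis diff_0_right diff_self)

lemma homogeneous_sum:
  fixes f :: "'b \<Rightarrow> 'k::comm_ring_1 pol3"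
  shows "(\<And>x. x \<in> S \<Longrightarrow> homogeneous d (f x)) \<Longrightarrow> homogeneous d (sum f S)"
  by (induction S rule: infinite_finite_induct) (auto intro: homogeneous_0 homogeneous_add)

lemma homogeneous_mult:
  fixes p :: "'k::comm_ring_1 pol3"
  assumes "homogeneous d p" "homogeneous e q" shows "homogeneous (d + e) (p * q)"
  unfolding homogeneous_def
proof (intro allI impI)
  fix i j k assume "mcoeff (p * q) i j k \<noteq> 0"
  then obtain k' j' i' where le: "k' \<le> k" "j' \<le> j" "i' \<le> i"
    and "mcoeff p i' j' k' * mcoeff q (i - i') (j - j') (k - k') \<noteq> 0"
    unfolding mcoeff_mult by (metis (no_types, lifting) atMost_iff sum.not_neutral_contains_not_neutral)
  then have "mcoeff p i' j' k' \<noteq> 0" "mcoeff q (i - i') (j - j') (k - k') \<noteq> 0" by auto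
  then have "i' + j' + k' = d" "(i - i') + (j - j') + (k - k') = e"
    using assms unfolding homogeneous_def by blast+
  with le show "i + j + k = d + e" by simp
qed

lemma homogeneous_mterm: "i + j + k = d \<Longrightarrow> homogeneous d (mterm c i j k)"
  by (auto simp: homogeneous_def mcoeff_mterm)

lemma homogeneous_pconst: "homogeneous 0 (pconst c)"
  using homogeneous_mterm[of 0 0 0 0 c] by (simp add: mterm_def)

lemma homogeneous_pvar: "homogeneous 1 (pvar i)"
  using index_3_cases[of i] homogeneous_mterm[of 1 0 0 1 1] homogeneous_mterm[of 0 1 0 1 1]
    homogeneous_mterm[of 0 0 1 1 1] by (auto simp: mterm_def)

lemma homogeneous_power:
  fixes p :: "'k::comm_ring_1 pol3"
  assumes "homogeneous d p" shows "homogeneous (n * d) (p ^ n)"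
proof (induction n)
  case 0
  then show ?case using homogeneous_pconst[of "1::'k"] by simp
next
  case (Suc n)
  then show ?case using homogeneous_mult[OF assms Suc] by simp
qed

lemma homogeneous_prod:
  fixes f :: "'b \<Rightarrow> 'k::comm_ring_1 pol3"
  assumes "finite S" "\<And>x. x \<in> S \<Longrightarrow> homogeneous 1 (f x)"
  shows "homogeneous (card S) (prod f S)"
  using assms
proof (induction S)
  case empty
  then show ?case using homogeneous_pconst[of "1::'k"] by simp
next
  case (insert x S)
  then have "homogeneous (1 + card S) (f x * prod f S)" by (intro homogeneous_mult) auto
  then show ?case using insert by simp
qed

lemma homogeneous_lin_form: "homogeneous 1 (lin_form a)"
  unfolding lin_form_def
  using homogeneous_mult[OF homogeneous_pconst homogeneous_pvar] by (intro homogeneous_sum) auto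

lemma homogeneous_eq_sum_mterm:
  fixes p :: "'k::comm_ring_1 pol3"
  assumes "homogeneous d p"
  shows "p = (\<Sum>(i, j, k)\<in>{(i, j, k). i + j + k = d}. mterm (mcoeff p i j k) i j k)" (is "p = sum ?f ?T")
proof (rule pol3_eqI)
  fix i j k
  have "?T \<subseteq> {..d} \<times> {..d} \<times> {..d}" by auto
  then have fin: "finite ?T" by (rule finite_subset) simp
  have "mcoeff (sum ?f ?T) i j k = (\<Sum>t\<in>?T. if t = (i, j, k) then mcoeff p i j k else 0)"
    unfolding mcoeff_simps by (intro sum.cong) (auto simp: mcoeff_mterm split: if_splits)
  also have "\<dots> = mcoeff p i j k" using fin assms by (auto simp: homogeneous_def)
  finally show "mcoeff p i j k = mcoeff (sum ?f ?T) i j k" by simp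
qed

lemma power_card_finite_field: "x ^ CARD('k) = x" for x :: "'k::{finite,field}"
proof (cases "x = 0")
  case True
  then show ?thesis by simp
next
  case False
  let ?U = "UNIV - {0::'k}"
  have "bij_betw ((*) x) ?U ?U"
    by (rule bij_betwI[where g = "\<lambda>y. y / x"]) (use False in auto)
  then have "\<Prod>?U = (\<Prod>y\<in>?U. x * y)" by (rule prod.reindex_bij_betw[symmetric])
  also have "\<dots> = x ^ card ?U * \<Prod>?U" by (simp add: prod.distrib)
  finally have "x ^ card ?U = 1" by simp
  moreover have "CARD('k) = Suc (card ?U)" by (simp add: card_Diff_singleton)
  ultimately show ?thesis by (simp only: power_Suc mult_1_right)
qed

text \<open>The coefficients of the cross product of the derivations
  \<open>\<Sum> x\<^sub>i \<partial>\<^sub>i\<close> and \<open>\<Sum> x\<^sub>i\<^sup>n \<partial>\<^sub>i\<close>.\<close>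
definition frob_minor :: "nat \<Rightarrow> 'k::comm_ring_1 pol3 ^ 3" where
  "frob_minor n = (\<chi> i. pvar (i + 1) * pvar (i + 2) ^ n - pvar (i + 2) * pvar (i + 1) ^ n)"

lemma frob_minor_simps:
  "frob_minor n $ 0 = pvar 1 * pvar 2 ^ n - pvar 2 * pvar 1 ^ n"
  "frob_minor n $ 1 = pvar 2 * pvar 0 ^ n - pvar 0 * pvar 2 ^ n"
  "frob_minor n $ 2 = pvar 0 * pvar 1 ^ n - pvar 1 * pvar 0 ^ n"
proof -
  have "(1 + 2 :: 3) = 0" "(2 + 1 :: 3) = 0" "(2 + 2 :: 3) = 1" "(1 + 1 :: 3) = 2"
    using three_eq_zero by (simp_all add: eq_numeral_iff_iszero)
  then show "frob_minor n $ 0 = pvar 1 * pvar 2 ^ n - pvar 2 * pvar 1 ^ n"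
    "frob_minor n $ 1 = pvar 2 * pvar 0 ^ n - pvar 0 * pvar 2 ^ n"
    "frob_minor n $ 2 = pvar 0 * pvar 1 ^ n - pvar 1 * pvar 0 ^ n"
    by (simp_all only: frob_minor_def vec_lambda_beta add_0)
qed

text \<open>Stating the degree condition as \<open>i + j + k + n + 1 = d\<close> rather than by subtraction makes this
  zero for \<open>d \<le> n\<close>.\<close>
definition minor_ideal :: "nat \<Rightarrow> nat \<Rightarrow> 'k::comm_ring_1 pol3 set" where
  "minor_ideal n d = {\<Sum>l\<in>UNIV. f $ l * frob_minor n $ l | f.
      \<forall>l i j k. mcoeff (f $ l) i j k \<noteq> 0 \<longrightarrow> i + j + k + n + 1 = d}"

lemma minor_ideal_0: "0 \<in> minor_ideal n d"
  unfolding minor_ideal_def by (rule CollectI, rule exI[of _ 0]) simp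

lemma minor_ideal_add:
  assumes "p \<in> minor_ideal n d" "q \<in> minor_ideal n d" shows "p + q \<in> minor_ideal n d"
proof -
  obtain f where f: "p = (\<Sum>l\<in>UNIV. f $ l * frob_minor n $ l)"
    "\<And>l i j k. mcoeff (f $ l) i j k \<noteq> 0 \<Longrightarrow> i + j + k + n + 1 = d"
    using assms(1) unfolding minor_ideal_def by blast
  obtain g where g: "q = (\<Sum>l\<in>UNIV. g $ l * frob_minor n $ l)"
    "\<And>l i j k. mcoeff (g $ l) i j k \<noteq> 0 \<Longrightarrow> i + j + k + n + 1 = d"
    using assms(2) unfolding minor_ideal_def by blast
  have "p + q = (\<Sum>l\<in>UNIV. (f + g) $ l * frob_minor n $ l)"
    unfolding f g by (simp add: algebra_simps sum.distrib)
  moreover have "i + j + k + n + 1 = d" if "mcoeff ((f + g) $ l) i j k \<noteq> 0" for l i j k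
    using that f(2)[of l i j k] g(2)[of l i j k] by (cases "mcoeff (f $ l) i j k = 0") simp_all
  ultimately show ?thesis unfolding minor_ideal_def by blast
qed

lemma minor_ideal_mterm:
  assumes "i + j + k + n + 1 = d"
  shows "mterm c i j k * frob_minor n $ l \<in> minor_ideal n d"
proof -
  let ?f = "axis l (mterm c i j k)"
  have "mterm c i j k * frob_minor n $ l = (\<Sum>l'\<in>UNIV. if l' = l then mterm c i j k * frob_minor n $ l else 0)"
    by simp
  also have "\<dots> = (\<Sum>l'\<in>UNIV. ?f $ l' * frob_minor n $ l')"
    by (intro sum.cong) (auto simp: axis_def)
  finally have "mterm c i j k * frob_minor n $ l = \<dots>" .
  moreover have "i' + j' + k' + n + 1 = d" if "mcoeff (?f $ l') i' j' k' \<noteq> 0" for l' i' j' k'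
    using that assms by (auto simp: axis_def mcoeff_mterm split: if_splits)
  ultimately show ?thesis unfolding minor_ideal_def by blast
qed

section \<open>Normal forms modulo the minors\<close>

text \<open>The blocks are sorted by the first variable that occurs: \<open>pvar 0\<close>, then
  \<open>pvar 1\<close>, then \<open>pvar 2\<close> alone; later variables have exponent below
  \<open>n\<close>. The strict guards keep the exponent of that first variable positive, so a block
  vanishes wherever its first variable does.\<close>

definition normal_form :: "nat \<Rightarrow> nat \<Rightarrow> (nat \<Rightarrow> nat \<Rightarrow> 'k) \<Rightarrow> (nat \<Rightarrow> 'k) \<Rightarrow> 'k \<Rightarrow> 'k::comm_ring_1 pol3" where
  "normal_form n d c e r =
     (\<Sum>j<n. \<Sum>k<n. if j + k < d then mterm (c j k) (d - j - k) j k else 0)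
     + (\<Sum>k<n. if k < d then mterm (e k) 0 (d - k) k else 0) + mterm r 0 0 d"

definition reducible_to_normal_form :: "nat \<Rightarrow> nat \<Rightarrow> 'k::comm_ring_1 pol3 \<Rightarrow> bool" where
  "reducible_to_normal_form n d p \<longleftrightarrow> (\<exists>c e r. p - normal_form n d c e r \<in> minor_ideal n d)"

lemma normal_form_add:
  "normal_form n d (\<lambda>j k. c j k + c' j k) (\<lambda>k. e k + e' k) (r + r')
     = normal_form n d c e r + normal_form n d c' e' r'"
proof -
  have *: "(if P then a + b else 0) = (if P then a else 0) + (if P then b else 0)"
    for P and a b :: "'a pol3" by simp
  show ?thesis unfolding normal_form_def mterm_add * sum.distrib by (simp only: add_ac)
qed

lemma normal_form_0: "normal_form n d (\<lambda>_ _. 0) (\<lambda>_. 0) 0 = 0"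
  by (simp add: normal_form_def cong: if_cong)

lemma reducible_to_normal_form_add:
  assumes "reducible_to_normal_form n d p" "reducible_to_normal_form n d q"
  shows "reducible_to_normal_form n d (p + q)"
proof -
  obtain c e r c' e' r' where "p - normal_form n d c e r \<in> minor_ideal n d"
    "q - normal_form n d c' e' r' \<in> minor_ideal n d"
    using assms unfolding reducible_to_normal_form_def by blast
  then have "p + q - normal_form n d (\<lambda>j k. c j k + c' j k) (\<lambda>k. e k + e' k) (r + r') \<in> minor_ideal n d"
    unfolding normal_form_add by (metis minor_ideal_add add_diff_add)
  then show ?thesis unfolding reducible_to_normal_form_def by blast
qed

lemma reducible_to_normal_form_0: "reducible_to_normal_form n d 0"
  unfolding reducible_to_normal_form_def
  using minor_ideal_0 normal_form_0 by (metis diff_0_right)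

lemma reducible_to_normal_form_sum:
  "(\<And>x. x \<in> S \<Longrightarrow> reducible_to_normal_form n d (f x)) \<Longrightarrow> reducible_to_normal_form n d (sum f S)"
  by (induction S rule: infinite_finite_induct)
    (auto intro: reducible_to_normal_form_0 reducible_to_normal_form_add)

lemma reducible_to_normal_form_cong:
  assumes "reducible_to_normal_form n d q" "p - q \<in> minor_ideal n d"
  shows "reducible_to_normal_form n d p"
proof -
  obtain c e r where "q - normal_form n d c e r \<in> minor_ideal n d"
    using assms unfolding reducible_to_normal_form_def by blast
  from minor_ideal_add[OF assms(2) this] show ?thesis
    unfolding reducible_to_normal_form_def by (metis diff_add_cancel add_diff_eq)
qed

lemma normal_form_monomials:
  assumes "j < n" "k < n" "j + k < d"
  shows "normal_form n d (\<lambda>j' k'. if j' = j \<and> k' = k then c else 0) (\<lambda>_. 0) 0 = mterm c (d - j - k) j k"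
proof -
  have "(\<Sum>j'<n. \<Sum>k'<n. if j' + k' < d then mterm (if j' = j \<and> k' = k then c else 0) (d - j' - k') j' k' else 0)
     = (\<Sum>j'<n. \<Sum>k'<n. if k' = k then if j' = j then mterm c (d - j - k) j k else 0 else 0)"
    using assms(3) by (intro sum.cong) auto
  then show ?thesis using assms by (simp add: normal_form_def cong: if_cong)
qed

lemma normal_form_monomials_x0_free:
  assumes "k < n" "k < d"
  shows "normal_form n d (\<lambda>_ _. 0) (\<lambda>k'. if k' = k then c else 0) 0 = mterm c 0 (d - k) k"
proof -
  have "(\<Sum>k'<n. if k' < d then mterm (if k' = k then c else 0) 0 (d - k') k' else 0)
     = (\<Sum>k'<n. if k' = k then mterm c 0 (d - k) k else 0)"
    using assms(2) by (intro sum.cong) auto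
  then show ?thesis using assms by (simp add: normal_form_def cong: if_cong)
qed

text \<open>Modulo the minors, \<open>n - 1\<close> units of exponent may be moved from a variable to an earlier one
  that already occurs; this stops only at the monomials of the normal form.\<close>
lemma reducible_to_normal_form_mterm:
  assumes "2 \<le> n" "i + j + k = d"
  shows "reducible_to_normal_form n d (mterm c i j k)"
  using assms(2)
\<comment> \<open>The weight 2 on \<open>k\<close> makes a move from \<open>pvar 2\<close> to
  \<open>pvar 1\<close> a decrease, by \<open>n - 1\<close>; the assumption \<open>2 \<le> n\<close>
  makes every move strict.\<close>
proof (induction "j + 2 * k" arbitrary: i j k rule: less_induct)
  case less
  \<comment> \<open>The first three cases are the possible moves, one per minor; the last three are
    the blocks of the normal form.\<close>
  consider "0 < i" "n \<le> j" | "0 < i" "n \<le> k" | "0 < j" "n \<le> k"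
    | "0 < i" "j < n" "k < n" | "i = 0" "0 < j" "k < n" | "i = 0" "j = 0"
    by (metis not_gr_zero not_le)
  then consider (a) i' j' where "i = Suc i'" "j = n + j'" | (b) i' k' where "i = Suc i'" "k = n + k'"
    | (c) j' k' where "j = Suc j'" "k = n + k'"
    | (1) "0 < i" "j < n" "k < n" | (2) "i = 0" "0 < j" "k < n" | (3) "i = 0" "j = 0"
    by cases (auto simp: gr0_conv_Suc le_iff_add)
  then show ?case
  proof cases
    case a
    let ?q = "mterm c (n + i') (Suc j') k"
    have "mterm c i j k - ?q = mterm c i' j' k * frob_minor n $ 2"
      unfolding a mterm_def frob_minor_simps by (simp add: algebra_simps power_add)
    moreover have "mterm c i' j' k * frob_minor n $ 2 \<in> minor_ideal n d"
      using less.prems a by (intro minor_ideal_mterm) simp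
    moreover have "reducible_to_normal_form n d ?q"
      using less.prems a assms(1) by (intro less.hyps) auto
    ultimately show ?thesis using reducible_to_normal_form_cong by metis
  next
    case b
    let ?q = "mterm c (n + i') j (Suc k')"
    \<comment> \<open>The sign comes from the cyclic orientation of the cross product.\<close>
    have "mterm c i j k - ?q = mterm (- c) i' j k' * frob_minor n $ 1"
      unfolding b mterm_def frob_minor_simps by (simp add: algebra_simps power_add)
    moreover have "mterm (- c) i' j k' * frob_minor n $ 1 \<in> minor_ideal n d"
      using less.prems b by (intro minor_ideal_mterm) simp
    moreover have "reducible_to_normal_form n d ?q"
      using less.prems b assms(1) by (intro less.hyps) auto
    ultimately show ?thesis using reducible_to_normal_form_cong by metis
  next
    case c
    let ?q = "mterm c i (n + j') (Suc k')"
    have "mterm c i j k - ?q = mterm c i j' k' * frob_minor n $ 0"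
      unfolding c mterm_def frob_minor_simps by (simp add: algebra_simps power_add)
    moreover have "mterm c i j' k' * frob_minor n $ 0 \<in> minor_ideal n d"
      using less.prems c by (intro minor_ideal_mterm) simp
    moreover have "reducible_to_normal_form n d ?q"
      using less.prems c assms(1) by (intro less.hyps) auto
    ultimately show ?thesis using reducible_to_normal_form_cong by metis
  next
    case 1
    then have "normal_form n d (\<lambda>j' k'. if j' = j \<and> k' = k then c else 0) (\<lambda>_. 0) 0 = mterm c i j k"
      using normal_form_monomials[of j n k d c] less.prems by auto
    then show ?thesis unfolding reducible_to_normal_form_def using minor_ideal_0 by (metis diff_self)
  next
    case 2
    then have "normal_form n d (\<lambda>_ _. 0) (\<lambda>k'. if k' = k then c else 0) 0 = mterm c i j k"
      using normal_form_monomials_x0_free[of k n d c] less.prems by auto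
    then show ?thesis unfolding reducible_to_normal_form_def using minor_ideal_0 by (metis diff_self)
  next
    case 3
    then have "normal_form n d (\<lambda>_ _. 0) (\<lambda>_. 0) c = mterm c i j k"
      using less.prems by (simp add: normal_form_def cong: if_cong)
    then show ?thesis unfolding reducible_to_normal_form_def using minor_ideal_0 by (metis diff_self)
  qed
qed

lemma homogeneous_reducible_to_normal_form:
  assumes "2 \<le> n" "homogeneous d p"
  shows "reducible_to_normal_form n d p"
  by (subst homogeneous_eq_sum_mterm[OF assms(2)])
    (auto intro!: reducible_to_normal_form_sum reducible_to_normal_form_mterm assms(1))

text \<open>A polynomial of degree below q with q roots is zero.\<close>

lemma coeffs_eq_0_if_vanishing:
  fixes f :: "nat \<Rightarrow> 'k::{finite,field}"
  assumes "\<And>z. (\<Sum>k<CARD('k). f k * z ^ k) = 0" "k < CARD('k)"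
  shows "f k = 0"
proof -
  let ?p = "\<Sum>k<CARD('k). monom (f k) k"
  have "poly ?p z = 0" for z using assms(1) by (simp add: poly_sum poly_monom)
  then have "{z. poly ?p z = 0} = UNIV" by auto
  moreover have "degree ?p < CARD('k)"
    by (intro degree_sum_less le_less_trans[OF degree_monom_le]) auto
  ultimately have "?p = 0" using card_poly_roots_bound[of ?p] by (metis not_le)
  then have "coeff ?p k = 0" by simp
  then show ?thesis using assms(2) by (simp add: coeff_sum)
qed

text \<open>The blocks are removed from the last to the first, by evaluating at (0, 0, 1), at (0, 1,
  z) and at (1, y, z). What remains each time has degree below q in every free coordinate, so its
  coefficients vanish.\<close>

lemma normal_form_eq_0_if_vanishing:
  fixes c :: "nat \<Rightarrow> nat \<Rightarrow> 'k::{finite,field}"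
  assumes v: "\<And>x. point_eval x (normal_form CARD('k) d c e r) = 0"
  shows "normal_form CARD('k) d c e r = 0"
proof -
  let ?q = "CARD('k)"
  \<comment> \<open>The guards move into the coefficients. Where truncated subtraction makes an
    exponent 0, and \<open>0 ^ 0\<close> would contribute 1, the coefficient is now 0.\<close>
  define c' where "c' j k = (if j + k < d then c j k else 0)" for j k
  define e' where "e' k = (if k < d then e k else 0)" for k
  have nf: "normal_form ?q d c e r = (\<Sum>j<?q. \<Sum>k<?q. mterm (c' j k) (d - j - k) j k)
     + (\<Sum>k<?q. mterm (e' k) 0 (d - k) k) + mterm r 0 0 d"
    unfolding normal_form_def c'_def e'_def by (intro arg_cong2[where f = "(+)"] sum.cong) auto
  define pt :: "'k \<Rightarrow> 'k \<Rightarrow> 'k \<Rightarrow> 'k ^ 3" where "pt x y z = (\<chi> i. if i = 0 then x else if i = 1 then y else z)" for x y z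
  have pt: "pt x y z $ 0 = x" "pt x y z $ 1 = y" "pt x y z $ 2 = z" for x y z
    by (simp_all add: pt_def)
  have ev: "(\<Sum>j<?q. \<Sum>k<?q. c' j k * x ^ (d - j - k) * y ^ j * z ^ k)
     + (\<Sum>k<?q. e' k * y ^ (d - k) * z ^ k) + r * z ^ d = 0" for x y z
    using v[of "pt x y z"] unfolding nf by (simp add: pt)
  have c0: "c' j k * 0 ^ (d - (j + k)) = 0" for j k by (auto simp: c'_def power_0_left)
  have e0: "e' k * 0 ^ (d - k) = 0" for k by (auto simp: e'_def power_0_left)
  have r: "r = 0" using ev[of 0 0 1] by (simp add: c0 e0)
  have e: "e' k = 0" if "k < ?q" for k
  proof (rule coeffs_eq_0_if_vanishing[OF _ that])
    show "(\<Sum>k<?q. e' k * z ^ k) = 0" for z using ev[of 0 1 z] by (simp add: c0 r)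
  qed
  have "(\<Sum>j<?q. (\<Sum>k<?q. c' j k * z ^ k) * y ^ j) = 0" for y z
  proof -
    have "(\<Sum>j<?q. (\<Sum>k<?q. c' j k * z ^ k) * y ^ j) = (\<Sum>j<?q. \<Sum>k<?q. c' j k * 1 ^ (d - j - k) * y ^ j * z ^ k)"
      unfolding sum_distrib_right by (intro sum.cong) auto
    then show ?thesis using ev[of 1 y z] by (simp add: e r)
  qed
  then have "(\<Sum>k<?q. c' j k * z ^ k) = 0" if "j < ?q" for j z
    using coeffs_eq_0_if_vanishing[of "\<lambda>j. \<Sum>k<?q. c' j k * z ^ k"] that by blast
  then have c: "c' j k = 0" if "j < ?q" "k < ?q" for j k
    using coeffs_eq_0_if_vanishing[of "c' j" k] that by blast
  show ?thesis unfolding nf by (simp add: c e r)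
qed

lemma point_eval_frob_minor:
  "point_eval x (frob_minor CARD('k) $ l) = 0" for x :: "'k::{finite,field} ^ 3"
  by (simp add: frob_minor_def power_card_finite_field)

lemma two_le_card_field: "2 \<le> CARD('k::{finite,field})"
proof -
  have "card {0, 1 :: 'k} \<le> CARD('k)" by (intro card_mono) auto
  then show ?thesis by simp
qed

text \<open>The minors vanish at all points because \<open>x ^ q = x\<close> there. So the normal
  form of \<open>p\<close> vanishes at all points as well, and is therefore zero.\<close>

lemma homogeneous_vanishing_in_minor_ideal:
  fixes p :: "'k::{finite,field} pol3"
  assumes "homogeneous d p" "\<And>x. point_eval x p = 0"
  shows "p \<in> minor_ideal CARD('k) d"
proof -
  obtain c e r where cer: "p - normal_form CARD('k) d c e r \<in> minor_ideal CARD('k) d"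
    using homogeneous_reducible_to_normal_form[OF two_le_card_field assms(1)]
    unfolding reducible_to_normal_form_def by blast
  then obtain f where f: "p - normal_form CARD('k) d c e r = (\<Sum>l\<in>UNIV. f $ l * frob_minor CARD('k) $ l)"
    unfolding minor_ideal_def by blast
  have "point_eval x (p - normal_form CARD('k) d c e r) = 0" for x
    unfolding f by (simp add: point_eval_frob_minor)
  then have "normal_form CARD('k) d c e r = 0"
    by (intro normal_form_eq_0_if_vanishing) (simp add: assms(2))
  then show ?thesis using cer by simp
qed

section \<open>Derivations and Saito's criterion\<close>

text \<open>The minors have degree \<open>n + 1\<close>. This gives both the additivity of the
  Frobenius power on linear forms and the bound q < |A|.\<close>

lemma minor_ideal_low_degree:
  assumes "p \<in> minor_ideal n d" "d \<le> n" shows "p = 0"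
proof -
  obtain f where f: "p = (\<Sum>l\<in>UNIV. f $ l * frob_minor n $ l)"
    "\<And>l i j k. mcoeff (f $ l) i j k \<noteq> 0 \<Longrightarrow> i + j + k + n + 1 = d"
    using assms(1) unfolding minor_ideal_def by blast
  have "mcoeff (f $ l) i j k = 0" for l i j k using f(2)[of l i j k] assms(2) by force
  then have "f $ l = 0" for l by (intro pol3_eqI) simp
  then show ?thesis using f(1) by simp
qed

text \<open>The two sides agree at every point, and their difference is homogeneous of degree q, one
  below the degree of the minors.\<close>

lemma lin_form_power_card:
  fixes a :: "'k::{finite,field} ^ 3"
  shows "lin_form a ^ CARD('k) = (\<Sum>i\<in>UNIV. pconst (a $ i) * pvar i ^ CARD('k))"
proof -
  let ?p = "lin_form a ^ CARD('k) - (\<Sum>i\<in>UNIV. pconst (a $ i) * pvar i ^ CARD('k))"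
  have "homogeneous (0 + CARD('k) * 1) (pconst (a $ i) * pvar i ^ CARD('k))" for i
    by (intro homogeneous_mult homogeneous_power homogeneous_pconst homogeneous_pvar)
  moreover have "homogeneous (CARD('k) * 1) (lin_form a ^ CARD('k))"
    by (intro homogeneous_power homogeneous_lin_form)
  ultimately have "homogeneous CARD('k) ?p"
    by (intro homogeneous_diff homogeneous_sum) simp_all
  moreover have "point_eval x ?p = 0" for x
    by (simp add: power_card_finite_field) (simp add: lin_fun_def)
  ultimately have "?p \<in> minor_ideal CARD('k) CARD('k)"
    by (rule homogeneous_vanishing_in_minor_ideal)
  then show ?thesis using minor_ideal_low_degree by fastforce
qed

text \<open>The Euler derivation for \<open>n\<close> = 1, the Frobenius derivation for
  \<open>n\<close> = q.\<close>

definition power_der :: "nat \<Rightarrow> 'k::comm_ring_1 pol3 ^ 3" where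
  "power_der n = (\<chi> i. pvar i ^ n)"

lemma homogeneous_power_der: "homogeneous_der n (power_der n)"
  unfolding homogeneous_der_def power_der_def
  by (simp add: homogeneous_power[OF homogeneous_pvar, of n, simplified])

lemma der_apply_power_der_1: "der_apply (power_der 1) a = lin_form a"
  by (simp add: der_apply_def power_der_def lin_form_def)

lemma der_apply_power_der_card:
  "der_apply (power_der CARD('k)) a = lin_form a ^ CARD('k)" for a :: "'k::{finite,field} ^ 3"
  by (simp add: der_apply_def power_der_def lin_form_power_card)

text \<open>The determinant with rows \<open>u\<close>, \<open>v\<close>, \<open>w\<close>, expanded
  along \<open>u\<close>.\<close>

definition triple :: "'a::comm_ring_1 ^ 3 \<Rightarrow> 'a ^ 3 \<Rightarrow> 'a ^ 3 \<Rightarrow> 'a" where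
  "triple u v w = u $ 0 * (v $ 1 * w $ 2 - v $ 2 * w $ 1) + u $ 1 * (v $ 2 * w $ 0 - v $ 0 * w $ 2)
     + u $ 2 * (v $ 0 * w $ 1 - v $ 1 * w $ 0)"

text \<open>Cramer's rule cleared of denominators.\<close>

lemma triple_cramer:
  "triple u v w *s x = triple x v w *s u + triple u x w *s v + triple u v x *s w"
  unfolding vec_eq_iff all_index_3 by (simp add: triple_def algebra_simps)

lemma triple_combination:
  "triple (a *s u + b *s v + c *s w) v w = a * triple u v w"
  "triple u (a *s u + b *s v + c *s w) w = b * triple u v w"
  "triple u v (a *s u + b *s v + c *s w) = c * triple u v w"
  by (simp_all add: triple_def algebra_simps)

text \<open>Expansion of the determinant along its last row. It turns membership in the ideal of the
  minors into a determinant as needed for Saito's criterion.\<close>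

lemma triple_power_der:
  "triple (power_der 1) (power_der n) f = (\<Sum>l\<in>UNIV. f $ l * frob_minor n $ l)"
  by (simp add: sum_UNIV_3 frob_minor_simps triple_def power_der_def algebra_simps)

lemma der_apply_3:
  "der_apply \<theta> a = pconst (a $ 0) * \<theta> $ 0 + pconst (a $ 1) * \<theta> $ 1 + pconst (a $ 2) * \<theta> $ 2"
  by (simp add: der_apply_def sum_UNIV_3)

lemma pconst_dvd_cancel:
  fixes c :: "'k::field"
  assumes "c \<noteq> 0" "m dvd pconst c * p" shows "m dvd p"
proof -
  have "m dvd pconst (inverse c) * (pconst c * p)" using assms(2) by simp
  moreover have "pconst (inverse c) * (pconst c * p) = p"
    using assms(1) by (simp add: mult.assoc[symmetric] flip: pconst_simps(6))
  ultimately show ?thesis by simp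
qed

lemma dvd_triple:
  fixes a :: "'k::field ^ 3"
  assumes "a \<noteq> 0" and dvd: "m dvd der_apply u a" "m dvd der_apply v a" "m dvd der_apply w a"
  shows "m dvd triple u v w"
proof -
  \<comment> \<open>Replacing column i of the determinant by the combination of all columns with
    coefficients \<open>a\<close> multiplies it by \<open>a $ i\<close>; the new column consists of
    the values \<open>der_apply\<close>, and the expansion is along it.\<close>
  have "pconst (a $ 0) * triple u v w = der_apply u a * (v $ 1 * w $ 2 - v $ 2 * w $ 1)
      + der_apply v a * (w $ 1 * u $ 2 - w $ 2 * u $ 1) + der_apply w a * (u $ 1 * v $ 2 - u $ 2 * v $ 1)"
    "pconst (a $ 1) * triple u v w = der_apply u a * (v $ 2 * w $ 0 - v $ 0 * w $ 2)
      + der_apply v a * (w $ 2 * u $ 0 - w $ 0 * u $ 2) + der_apply w a * (u $ 2 * v $ 0 - u $ 0 * v $ 2)"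
    "pconst (a $ 2) * triple u v w = der_apply u a * (v $ 0 * w $ 1 - v $ 1 * w $ 0)
      + der_apply v a * (w $ 0 * u $ 1 - w $ 1 * u $ 0) + der_apply w a * (u $ 0 * v $ 1 - u $ 1 * v $ 0)"
    unfolding triple_def der_apply_3 by (simp_all add: algebra_simps)
  then have "\<forall>i. m dvd pconst (a $ i) * triple u v w"
    unfolding all_index_3 using dvd by simp
  moreover obtain i where "a $ i \<noteq> 0" using assms(1) by (auto simp: vec_eq_iff)
  ultimately show ?thesis using pconst_dvd_cancel by blast
qed

text \<open>Modulo \<open>m\<close>, both power derivations are orthogonal to \<open>a\<close>, so their cross product is
  parallel to \<open>a\<close>.\<close>
lemma dvd_minor_mult_der_apply:
  fixes a :: "'k::field ^ 3"
  assumes "m dvd der_apply (power_der 1) a" "m dvd der_apply (power_der n) a"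
    and "m dvd triple (power_der 1) (power_der n) f"
  shows "m dvd frob_minor n $ i * der_apply f a"
proof -
  let ?u = "power_der 1 :: 'k pol3 ^ 3" and ?v = "power_der n :: 'k pol3 ^ 3"
  let ?T = "triple ?u ?v f" and ?U = "der_apply ?u a" and ?V = "der_apply ?v a"
  have "frob_minor n $ 0 * der_apply f a = pconst (a $ 0) * ?T
      + ?U * (?v $ 2 * f $ 1 - ?v $ 1 * f $ 2) + ?V * (?u $ 1 * f $ 2 - ?u $ 2 * f $ 1)"
    "frob_minor n $ 1 * der_apply f a = pconst (a $ 1) * ?T
      + ?U * (?v $ 0 * f $ 2 - ?v $ 2 * f $ 0) + ?V * (?u $ 2 * f $ 0 - ?u $ 0 * f $ 2)"
    "frob_minor n $ 2 * der_apply f a = pconst (a $ 2) * ?T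
      + ?U * (?v $ 1 * f $ 0 - ?v $ 0 * f $ 1) + ?V * (?u $ 0 * f $ 1 - ?u $ 1 * f $ 0)"
    unfolding triple_def der_apply_3 by (simp_all add: frob_minor_simps power_der_def algebra_simps)
  then have "\<forall>i. m dvd frob_minor n $ i * der_apply f a"
    unfolding all_index_3 using assms by simp
  then show ?thesis by blast
qed

lemma frob_minor_neq_0:
  assumes "2 \<le> n" shows "frob_minor n $ i \<noteq> (0 :: 'k::comm_ring_1 pol3)"
proof -
  have "frob_minor n $ 0 = mterm 1 0 1 n - mterm (1::'k) 0 n 1"
    "frob_minor n $ 1 = mterm 1 n 0 1 - mterm (1::'k) 1 0 n"
    "frob_minor n $ 2 = mterm 1 1 n 0 - mterm (1::'k) n 1 0"
    by (simp_all add: frob_minor_simps mterm_def mult.commute)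
  then have "mcoeff (frob_minor n $ 0 :: 'k pol3) 0 1 n = 1" "mcoeff (frob_minor n $ 1 :: 'k pol3) n 0 1 = 1"
    "mcoeff (frob_minor n $ 2 :: 'k pol3) 1 n 0 = 1"
    using assms by (simp_all add: mcoeff_mterm)
  then have "\<forall>i. frob_minor n $ i \<noteq> (0 :: 'k pol3)"
    unfolding all_index_3 by (metis mcoeff_simps(1) zero_neq_one)
  then show ?thesis by blast
qed

text \<open>The i-th minor involves only the other two variables, so the substitution that
  eliminates \<open>pvar i\<close> fixes it and does not send it to 0.\<close>

lemma lin_form_not_dvd_frob_minor:
  fixes a :: "'k::field ^ 3"
  assumes "a $ i \<noteq> 0" "2 \<le> n" shows "\<not> lin_form a dvd frob_minor n $ i"
proof -
  let ?e = "peval pconst (lin_subst a i)"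
  have hom: "ring_hom_fun ?e" by (intro ring_hom_fun_peval ring_hom_fun_pconst)
  have "j \<noteq> i \<Longrightarrow> ?e (pvar j) = pvar j" for j
    by (simp add: peval_pvar ring_hom_fun_pconst lin_subst_def)
  moreover have "i + 1 \<noteq> i" "i + 2 \<noteq> i" by simp_all
  ultimately have "?e (frob_minor n $ i) = frob_minor n $ i"
    using hom by (simp add: frob_minor_def ring_hom_fun_diff[OF hom] ring_hom_fun_power[OF hom])
      (simp add: ring_hom_fun_def ring_hom_fun_power[OF hom])
  then show ?thesis using lin_form_dvd_iff[OF assms(1)] frob_minor_neq_0[OF assms(2)] by metis
qed

lemma prime_elem_not_dvd_prod:
  assumes "prime_elem p" "finite S" "\<And>y. y \<in> S \<Longrightarrow> \<not> p dvd f y"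
  shows "\<not> p dvd prod f S"
  using assms(2,3)
proof (induction S)
  case empty
  then show ?case using assms(1) by (simp add: prime_elem_def)
next
  case (insert x S)
  then show ?case using assms(1) by (simp add: prime_elem_dvd_mult_iff)
qed

text \<open>Once the product over \<open>S\<close> is split off from \<open>m\<close>, a further
  prime divides no factor of that product, hence divides the cofactor.\<close>

lemma prod_dvd_if_primes_dvd:
  fixes f :: "'b \<Rightarrow> 'a::idom"
  assumes "finite S" "\<And>x. x \<in> S \<Longrightarrow> prime_elem (f x)"
    and "\<And>x y. x \<in> S \<Longrightarrow> y \<in> S \<Longrightarrow> x \<noteq> y \<Longrightarrow> \<not> f x dvd f y"
    and "\<And>x. x \<in> S \<Longrightarrow> f x dvd m"
  shows "prod f S dvd m"
  using assms
proof (induction S)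
  case empty
  then show ?case by simp
next
  case (insert x S)
  then obtain g where g: "m = prod f S * g" by (auto elim: dvdE)
  have "\<not> f x dvd prod f S"
    using insert.hyps insert.prems by (intro prime_elem_not_dvd_prod) auto
  then have "f x dvd g"
    using insert.prems g by (metis insertI1 prime_elem_dvd_mult_iff)
  then show ?case using insert.hyps g by (simp add: mult.commute mult_dvd_mono)
qed

text \<open>\<open>der_module\<close> quantifies over all normals of a hyperplane. One normal
  \<open>N H\<close> suffices, since any two are proportional.\<close>

lemma der_moduleI:
  assumes "\<And>H. H \<in> A \<Longrightarrow> N H \<noteq> 0 \<and> H = {x. lin_fun (N H) x = 0}"
    and "\<And>H. H \<in> A \<Longrightarrow> lin_form (N H) dvd der_apply \<theta> (N H)"
  shows "\<theta> \<in> der_module A"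
  unfolding der_module_def
proof (intro CollectI ballI allI impI, elim conjE)
  fix H a assume H: "H \<in> A" and a: "a \<noteq> 0" "H = {x. lin_fun a x = 0}"
  obtain i where i: "N H $ i \<noteq> 0" using assms(1)[OF H] by (auto simp: vec_eq_iff)
  have "{x. lin_fun (N H) x = 0} \<subseteq> {x. lin_fun a x = 0}" using assms(1)[OF H] a(2) by simp
  from lin_fun_kernel_subset[OF i this] obtain c where c: "a = c *s N H" by blast
  then show "lin_form a dvd der_apply \<theta> a"
    using assms(2)[OF H] by (simp add: lin_form_scale der_apply_scale mult_dvd_mono)
qed

text \<open>Saito's criterion: Cramer's rule expresses \<open>\<theta>\<close> over the fraction field, and each numerator is
  divisible by every \<open>lin_form (N H)\<close>, hence by their product.\<close>
lemma free_with_exponentsI: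
  fixes A :: "('k::field ^ 3) set set"
  assumes "finite A" and N: "\<And>H. H \<in> A \<Longrightarrow> N H \<noteq> 0 \<and> H = {x. lin_fun (N H) x = 0}"
    and mem: "\<theta>1 \<in> der_module A" "\<theta>2 \<in> der_module A" "\<theta>3 \<in> der_module A"
    and hom: "homogeneous_der d1 \<theta>1" "homogeneous_der d2 \<theta>2" "homogeneous_der d3 \<theta>3"
    and Q: "triple \<theta>1 \<theta>2 \<theta>3 = (\<Prod>H\<in>A. lin_form (N H))"
  shows "free_with_exponents A d1 d2 d3"
proof -
  let ?Q = "triple \<theta>1 \<theta>2 \<theta>3"
  have Q0: "?Q \<noteq> 0" unfolding Q using assms(1) N by (metis lin_form_neq_0 prod_zero_iff)
  have dvd: "?Q dvd triple u v w" if "u \<in> der_module A" "v \<in> der_module A" "w \<in> der_module A" for u v w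
    unfolding Q
  proof (rule prod_dvd_if_primes_dvd[OF assms(1)])
    fix H assume H: "H \<in> A"
    show "prime_elem (lin_form (N H))" using N[OF H] prime_elem_lin_form by blast
    have "lin_form (N H) dvd der_apply \<theta> (N H)" if "\<theta> \<in> der_module A" for \<theta>
      using that H N[OF H] unfolding der_module_def by blast
    then show "lin_form (N H) dvd triple u v w"
      using N[OF H] that by (intro dvd_triple[of "N H"]) auto
  next
    fix H H' assume "H \<in> A" "H' \<in> A" "H \<noteq> H'"
    then show "\<not> lin_form (N H) dvd lin_form (N H')"
      using N[of H] N[of H'] by (intro lin_form_not_dvd) auto
  qed
  have "\<exists>!(g1, g2, g3). \<theta> = g1 *s \<theta>1 + g2 *s \<theta>2 + g3 *s \<theta>3" if \<theta>: "\<theta> \<in> der_module A" for \<theta>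
  proof -
    obtain g1 g2 g3 where g: "triple \<theta> \<theta>2 \<theta>3 = ?Q * g1" "triple \<theta>1 \<theta> \<theta>3 = ?Q * g2" "triple \<theta>1 \<theta>2 \<theta> = ?Q * g3"
      using dvd mem \<theta> by (meson dvdE)
    \<comment> \<open>The nonzero factor \<open>?Q\<close> can be cancelled because the polynomial
      ring is a domain.\<close>
    have "?Q *s \<theta> = ?Q *s (g1 *s \<theta>1 + g2 *s \<theta>2 + g3 *s \<theta>3)"
      unfolding triple_cramer[of \<theta>1 \<theta>2 \<theta>3 \<theta>] g by (simp add: vec_eq_iff algebra_simps)
    then have eq: "\<theta> = g1 *s \<theta>1 + g2 *s \<theta>2 + g3 *s \<theta>3"
      using Q0 by (simp add: vec_eq_iff)
    \<comment> \<open>The determinants recover the coefficients: each is the corresponding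
      coefficient times \<open>?Q\<close>.\<close>
    have uniq: "h1 = g1 \<and> h2 = g2 \<and> h3 = g3" if h: "\<theta> = h1 *s \<theta>1 + h2 *s \<theta>2 + h3 *s \<theta>3" for h1 h2 h3
    proof -
      have "triple \<theta> \<theta>2 \<theta>3 = h1 * ?Q" "triple \<theta>1 \<theta> \<theta>3 = h2 * ?Q" "triple \<theta>1 \<theta>2 \<theta> = h3 * ?Q"
        unfolding h triple_combination by (rule refl)+
      with g Q0 show ?thesis by (simp add: mult.commute)
    qed
    show ?thesis
    proof (rule ex1I[of _ "(g1, g2, g3)"])
      fix y assume "case y of (g1, g2, g3) \<Rightarrow> \<theta> = g1 *s \<theta>1 + g2 *s \<theta>2 + g3 *s \<theta>3"
      then show "y = (g1, g2, g3)" using uniq by (cases y) auto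
    qed (use eq in auto)
  qed
  then show ?thesis unfolding free_with_exponents_def using mem hom by blast
qed

theorem mainTheorem5:
  fixes A :: "('k::{finite,field} ^ 3) set set"
  assumes "central_arrangement A"
    and "poly (char_poly A) (int CARD('k)) = 0"
  shows "\<exists>d3. int d3 = int (card A) - int CARD('k) - 1
           \<and> free_with_exponents A 1 CARD('k) d3"
proof -
  let ?q = "CARD('k)"
  have fin: "finite A" and "\<forall>H\<in>A. is_hyperplane H"
    using assms(1) by (auto simp: central_arrangement_def)
  then obtain N where N: "\<And>H. H \<in> A \<Longrightarrow> N H \<noteq> 0 \<and> H = {x. lin_fun (N H) x = 0}"
    unfolding is_hyperplane_def by metis
  define Q where "Q = (\<Prod>H\<in>A. lin_form (N H))"
  have cover: "\<Union>A = UNIV"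
    using poly_char_poly_card[OF assms(1)] assms(2) by auto
  have "point_eval x Q = 0" for x
  proof -
    obtain H where "H \<in> A" "x \<in> H" using cover by blast
    then have "lin_fun (N H) x = 0" using N by blast
    then show ?thesis unfolding Q_def using fin \<open>H \<in> A\<close> by (auto simp: prod_zero_iff)
  qed
  moreover have "homogeneous (card A) Q"
    unfolding Q_def by (intro homogeneous_prod fin homogeneous_lin_form)
  ultimately have Q_mem: "Q \<in> minor_ideal ?q (card A)"
    by (intro homogeneous_vanishing_in_minor_ideal)
  have "Q \<noteq> 0" unfolding Q_def using fin N by (metis lin_form_neq_0 prod_zero_iff)
  \<comment> \<open>This makes the third exponent |A| - q - 1 a natural number.\<close>
  then have "?q < card A" using minor_ideal_low_degree[OF Q_mem] by (meson not_le)
  then obtain d3 where d3: "card A = d3 + ?q + 1" by (metis add.commute add.left_commute less_imp_Suc_add Suc_eq_plus1)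
  \<comment> \<open>The coefficient vector \<open>f\<close> is the third basis derivation; the
    degree condition makes it homogeneous of degree \<open>d3\<close>.\<close>
  obtain f where f: "Q = (\<Sum>l\<in>UNIV. f $ l * frob_minor ?q $ l)"
    "\<And>l i j k. mcoeff (f $ l) i j k \<noteq> 0 \<Longrightarrow> i + j + k + ?q + 1 = card A"
    using Q_mem unfolding minor_ideal_def by blast
  have hom_f: "homogeneous_der d3 f"
    unfolding homogeneous_der_def homogeneous_def using f(2) d3 by fastforce
  have T: "triple (power_der 1) (power_der ?q) f = Q"
    unfolding triple_power_der f(1) ..
  have D1: "lin_form a dvd der_apply (power_der 1) a" for a :: "'k ^ 3"
    unfolding der_apply_power_der_1 by (rule dvd_refl)
  have Dq: "lin_form a dvd der_apply (power_der ?q) a" for a :: "'k ^ 3"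
    by (simp add: der_apply_power_der_card dvd_power)
  have "lin_form (N H) dvd der_apply f (N H)" if H: "H \<in> A" for H
  proof -
    \<comment> \<open>For such an index the prime \<open>lin_form (N H)\<close> does not divide the
      i-th minor. It does divide the minor times \<open>der_apply f (N H)\<close>, hence the second
      factor.\<close>
    obtain i where i: "N H $ i \<noteq> 0" using N[OF H] by (auto simp: vec_eq_iff)
    have "lin_form (N H) dvd Q" unfolding Q_def using fin H by (rule dvd_prodI)
    then have "lin_form (N H) dvd frob_minor ?q $ i * der_apply f (N H)"
      by (intro dvd_minor_mult_der_apply D1 Dq) (simp only: T)
    moreover have "\<not> lin_form (N H) dvd frob_minor ?q $ i"
      by (rule lin_form_not_dvd_frob_minor[OF i two_le_card_field])
    moreover have "prime_elem (lin_form (N H))" using N[OF H] prime_elem_lin_form by blast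
    ultimately show ?thesis using prime_elem_dvd_mult_iff by blast
  qed
  then have f_mem: "f \<in> der_module A" using N by (intro der_moduleI[of A N])
  have power_mem: "power_der 1 \<in> der_module A" "power_der ?q \<in> der_module A"
    using N D1 Dq by (intro der_moduleI[of A N]; blast)+
  have "free_with_exponents A 1 ?q d3"
    using fin N power_mem f_mem homogeneous_power_der homogeneous_power_der hom_f T[unfolded Q_def]
    by (rule free_with_exponentsI)
  moreover have "int d3 = int (card A) - int ?q - 1" using d3 by simp
  ultimately show ?thesis by blast
qed

end
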